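(* Let $R$ be a solution of finite order $\ge2$ on a set $X$ and $m$ a positive integer. Then the order $\mathrm{o}(R)$ of $R$ is even, and $\mathrm{o}(R)=2m$ if and only if $(X,R)\cong(A\times B,R_\omega)$ for a permutation $\omega:B\to B$ of order $m$ in $\Sigma_B$, where $A$ and $B$ are non-empty sets and $$R_\omega\bigl((a_1,b_1),(a_2,b_2)\bigr)=\bigl((a_1,b_2),(a_2,\omega(b_1))\bigr)$$ for all $a_1,a_2\in A$, $b_1,b_2\in B$. In particular, if $X$ is a finite set with $|X|=n$, then the maximum order of a solution on $X$ is $2\,g(n)$, and the number of isomorphism classes of solutions of finite order $\ge2$ on $X$ is equal to $$\sum_{d\mid n}\Bigl(\sum_{k=1}^{g(d)}\overline{T(d,k)}\Bigr),$$ where $g(d)$ is the Landau number of $d$.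
   Context: All sets are non-empty. $\Sigma_B$ is the group of all permutations of $B$. For a set $X$ let $\tau_X(x,y)=(y,x)$ be the flip map on $X\times X$. For a map $R:X\times X\to X\times X$ put, as maps $X^3\to X^3$, $R^{12}=R\times \mathrm{Id}_X$, $R^{23}=\mathrm{Id}_X\times R$, $R^{13}=(\mathrm{Id}_X\times\tau_X)\circ R^{12}\circ(\mathrm{Id}_X\times\tau_X)$. $R$ is called a solution on $X$ (of the set-theoretic Frobenius-Separability equation) if $R^{12}R^{23}=R^{23}R^{13}=R^{13}R^{12}$. $R$ has finite order if $R^k=\mathrm{Id}_{X\times X}$ for some positive integer $k$, and $\mathrm{o}(R)$ is then the least such $k$. An isomorphism of solutions $(X,R)\to(X',R')$ is a bijection $\sigma:X\to X'$ with $(\sigma\times\sigma)\circ R=R'\circ(\sigma\times\sigma)$. For a positive integer $n$, the Landau number $g(n)$ is the maximum order of a permutation in the symmetric group $S_n$, and $\overline{T(n,k)}$ is the number of conjugacy classes of permutations of order $k$ in $S_n$.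
   Formalization: The maximum order 2g(n) is stated for n ≥ 2 (for n = 1 it is 1). The printed sum also counts the identity (d = 1, order 1), so it is proved for all classes of finite order, and the number of classes of finite order ≥ 2 is the sum over d | n with d ≠ 1. *)

theory Defs
  imports
    "HOL-Algebra.Bij"
    "HOL-Algebra.Sym_Groups"
    "HOL-Algebra.Multiplicative_Group"
begin

text \<open>Maps on \<open>X \<times> X\<close> are total functions on pairs; their values outside \<open>X \<times> X\<close> are
  arbitrary, and every notion below only looks at them on \<open>X \<times> X\<close>. The set \<open>X\<^sup>3\<close> is
  \<open>X \<times> (X \<times> X)\<close>.\<close>

definition R12 :: "('a \<times> 'a \<Rightarrow> 'a \<times> 'a) \<Rightarrow> 'a \<times> 'a \<times> 'a \<Rightarrow> 'a \<times> 'a \<times> 'a" where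
  "R12 R = (\<lambda>(x, y, z). case R (x, y) of (u, v) \<Rightarrow> (u, v, z))"

definition R23 :: "('a \<times> 'a \<Rightarrow> 'a \<times> 'a) \<Rightarrow> 'a \<times> 'a \<times> 'a \<Rightarrow> 'a \<times> 'a \<times> 'a" where
  "R23 R = map_prod id R"

definition R13 :: "('a \<times> 'a \<Rightarrow> 'a \<times> 'a) \<Rightarrow> 'a \<times> 'a \<times> 'a \<Rightarrow> 'a \<times> 'a \<times> 'a" where
  "R13 R = map_prod id prod.swap \<circ> R12 R \<circ> map_prod id prod.swap"

definition FS_solution :: "'a set \<Rightarrow> ('a \<times> 'a \<Rightarrow> 'a \<times> 'a) \<Rightarrow> bool" where
  "FS_solution X R \<longleftrightarrow> R \<in> X \<times> X \<rightarrow> X \<times> X \<and>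
     (\<forall>t \<in> X \<times> X \<times> X. (R12 R \<circ> R23 R) t = (R23 R \<circ> R13 R) t \<and>
                     (R23 R \<circ> R13 R) t = (R13 R \<circ> R12 R) t)"

definition finite_order :: "'a set \<Rightarrow> ('a \<times> 'a \<Rightarrow> 'a \<times> 'a) \<Rightarrow> bool" where
  "finite_order X R \<longleftrightarrow> (\<exists>k>0. \<forall>p \<in> X \<times> X. (R ^^ k) p = p)"

text \<open>Only meaningful if \<open>finite_order X R\<close>.\<close>
definition map_order :: "'a set \<Rightarrow> ('a \<times> 'a \<Rightarrow> 'a \<times> 'a) \<Rightarrow> nat" where
  "map_order X R = (LEAST k. 0 < k \<and> (\<forall>p \<in> X \<times> X. (R ^^ k) p = p))"

definition isomorphic ::
    "'a set \<Rightarrow> ('a \<times> 'a \<Rightarrow> 'a \<times> 'a) \<Rightarrow> 'b set \<Rightarrow> ('b \<times> 'b \<Rightarrow> 'b \<times> 'b) \<Rightarrow> bool" where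
  "isomorphic X R X' R' \<longleftrightarrow>
     (\<exists>\<sigma>. bij_betw \<sigma> X X' \<and>
          (\<forall>p \<in> X \<times> X. (map_prod \<sigma> \<sigma> \<circ> R) p = (R' \<circ> map_prod \<sigma> \<sigma>) p))"

text \<open>If \<open>B\<close> is a singleton, then \<open>R_perm \<omega>\<close> is the identity on \<open>(A \<times> B) \<times> (A \<times> B)\<close>, so it
  has order 1; otherwise its order is twice that of \<open>\<omega>\<close>.\<close>
definition R_perm :: "('b \<Rightarrow> 'b) \<Rightarrow> ('a \<times> 'b) \<times> ('a \<times> 'b) \<Rightarrow> ('a \<times> 'b) \<times> ('a \<times> 'b)" where
  "R_perm \<omega> = (\<lambda>((a\<^sub>1, b\<^sub>1), (a\<^sub>2, b\<^sub>2)). ((a\<^sub>1, b\<^sub>2), (a\<^sub>2, \<omega> b\<^sub>1)))"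

definition landau :: "nat \<Rightarrow> nat" where
  "landau n = Max (group.ord (sym_group n) ` carrier (sym_group n))"

definition conj_class :: "('g, 'm) monoid_scheme \<Rightarrow> 'g \<Rightarrow> 'g set" where
  "conj_class G x = {h \<otimes>\<^bsub>G\<^esub> x \<otimes>\<^bsub>G\<^esub> inv\<^bsub>G\<^esub> h | h. h \<in> carrier G}"

definition num_conj_classes :: "nat \<Rightarrow> nat \<Rightarrow> nat" where
  "num_conj_classes n k =
     card (conj_class (sym_group n) `
             {p \<in> carrier (sym_group n). group.ord (sym_group n) p = k})"

text \<open>The isomorphism classes of a set \<open>S\<close> of maps on \<open>X \<times> X\<close>. Maps that agree on \<open>X \<times> X\<close>
  are isomorphic via the identity of \<open>X\<close>, so values outside \<open>X \<times> X\<close> do not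
  affect the number of classes.\<close>
definition iso_classes ::
    "'a set \<Rightarrow> ('a \<times> 'a \<Rightarrow> 'a \<times> 'a) set \<Rightarrow> ('a \<times> 'a \<Rightarrow> 'a \<times> 'a) set set" where
  "iso_classes X S = S // {(R, R'). R \<in> S \<and> R' \<in> S \<and> isomorphic X R X R'}"

end

theory Submission
  imports Defs
begin

text \<open>
  Write \<open>R (x, y) = (f x y, g x y)\<close>. The Frobenius-Separability equation for \<open>R\<close> becomes six
  identities for \<open>f\<close> and \<open>g\<close> (lemma \<open>FS_solution_iff\<close>). Two of them,
  \<open>f x (f y z) = f x z = f (f x y) z\<close>, say that \<open>f\<close> is almost a rectangular band; what is missing
  is \<open>f x x = x\<close>, and this follows as soon as every element is a value of \<open>f\<close>, which holds for
  a surjective \<open>R\<close> and hence for one of finite order. A rectangular band is a product \<open>A \<times> B\<close> with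
  \<open>f (a, b) (a', b') = (a, b')\<close>, and the other four identities force
  \<open>g (a, b) (a', b') = (a', \<omega> b)\<close> for a map \<open>\<omega>\<close> of \<open>B\<close>. So \<open>R\<close> is isomorphic to \<open>R_perm \<omega>\<close>
  (lemma \<open>surjective_solution_isomorphic_R_perm\<close>).

  The square of \<open>R_perm \<omega>\<close> applies \<open>\<omega>\<close> to both \<open>B\<close>-coordinates, while an odd power exchanges
  these coordinates up to powers of \<open>\<omega>\<close>, so that it cannot be the identity once \<open>B\<close> has two
  elements. Hence the order of \<open>R_perm \<omega>\<close> is twice the order of \<open>\<omega>\<close>, except that it is \<open>1\<close> when
  \<open>B\<close> is a singleton (lemma \<open>has_order_R_perm\<close>). This gives the characterization of
  \<open>o(R) = 2 m\<close> and, because a permutation of \<open>B\<close> with \<open>|B| \<le> n\<close> has order at most \<open>g(n)\<close>, the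
  maximal order \<open>2 g(n)\<close>.

  For the count, an isomorphism between two such maps preserves \<open>f\<close>, therefore the product
  decomposition, and so it induces a bijection between the sets \<open>B\<close> which conjugates one
  permutation into the other. For \<open>X\<close> with \<open>n\<close> elements a complete invariant of \<open>R\<close> is thus the
  divisor \<open>d = |B|\<close> of \<open>n\<close> together with a conjugacy class of the symmetric group of degree \<open>d\<close>
  (lemma \<open>standard_form_isomorphic_iff\<close>), and every such pair occurs. The conjugacy classes of
  degree \<open>d\<close> are counted order by order, and \<open>d = 1\<close> is the class of the identity, the only
  one of order less than \<open>2\<close>.
\<close>

section \<open>The order of a map on a set\<close>

text \<open>The order is described by the set of exponents that give the identity: they are the multiples
of \<open>m\<close>, where \<open>m = 0\<close> stands for infinite order. For a self-map of \<open>S\<close> the values outside \<open>S\<close>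
do not matter, so that \<open>map_order\<close>, the order of an element of \<open>BijGroup\<close> and that of an element
of \<open>sym_group\<close> can all be compared through this predicate.\<close>
definition has_order :: "'x set \<Rightarrow> ('x \<Rightarrow> 'x) \<Rightarrow> nat \<Rightarrow> bool" where
  "has_order S F m \<longleftrightarrow> (\<forall>k. (\<forall>x\<in>S. (F ^^ k) x = x) \<longleftrightarrow> m dvd k)"

lemma has_order_unique: "has_order S F m \<Longrightarrow> has_order S F m' \<Longrightarrow> m = m'"
  unfolding has_order_def by (metis dvd_antisym dvd_refl)

lemma funpow_closed: "F \<in> S \<rightarrow> S \<Longrightarrow> x \<in> S \<Longrightarrow> (F ^^ k) x \<in> S"
  by (induction k) auto

lemma funpow_conj:
  assumes "F \<in> S \<rightarrow> S" "\<forall>x\<in>S. s (F x) = G (s x)" "x \<in> S"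
  shows "s ((F ^^ k) x) = (G ^^ k) (s x)"
  by (induction k) (use assms in \<open>auto simp: funpow_closed\<close>)

lemma funpow_fixes_conj:
  assumes "F \<in> S \<rightarrow> S" "bij_betw s S T" "\<forall>x\<in>S. s (F x) = G (s x)"
  shows "(\<forall>x\<in>S. (F ^^ k) x = x) \<longleftrightarrow> (\<forall>y\<in>T. (G ^^ k) y = y)"
proof -
  have "(F ^^ k) x = x \<longleftrightarrow> (G ^^ k) (s x) = s x" if "x \<in> S" for x
    using funpow_conj[OF assms(1,3) that, of k] funpow_closed[OF assms(1) that, of k] assms(2) that
    by (metis bij_betw_def inj_on_eq_iff)
  then show ?thesis using assms(2) by (auto simp: bij_betw_def)
qed

lemma has_order_conj:
  assumes "F \<in> S \<rightarrow> S" "bij_betw s S T" "\<forall>x\<in>S. s (F x) = G (s x)"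
  shows "has_order S F m \<longleftrightarrow> has_order T G m"
  unfolding has_order_def using funpow_fixes_conj[OF assms] by simp

lemma bij_betw_if_funpow_id:
  assumes "F \<in> S \<rightarrow> S" "0 < k" "\<forall>x\<in>S. (F ^^ k) x = x"
  shows "bij_betw F S S"
proof -
  obtain j where k: "k = Suc j" using assms(2) gr0_implies_Suc by blast
  show ?thesis
  proof (rule bij_betw_byWitness[where f' = "F ^^ j"])
    show "\<forall>x\<in>S. (F ^^ j) (F x) = x" using assms(3) by (simp add: k funpow_swap1)
    show "\<forall>x\<in>S. F ((F ^^ j) x) = x" using assms(3) by (simp add: k)
  qed (use assms(1) in \<open>auto simp: funpow_closed\<close>)
qed

lemma has_order_map_order:
  assumes "has_order (X \<times> X) R m" "0 < m"
  shows "finite_order X R" "map_order X R = m"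
proof -
  show "finite_order X R" using assms unfolding finite_order_def has_order_def by auto
  show "map_order X R = m" unfolding map_order_def
    by (rule Least_equality) (use assms in \<open>auto simp: has_order_def dvd_imp_le\<close>)
qed

section \<open>Orders in permutation groups and Landau numbers\<close>

lemma BijGroup_nat_pow_apply:
  assumes "\<omega> \<in> carrier (BijGroup B)" "b \<in> B"
  shows "(\<omega> [^]\<^bsub>BijGroup B\<^esub> (k::nat)) b = (\<omega> ^^ k) b"
proof -
  interpret group "BijGroup B" by (rule group_BijGroup)
  show ?thesis using assms(2)
  proof (induction k arbitrary: b)
    case 0 then show ?case by (simp add: BijGroup_def)
  next
    case (Suc k)
    have c: "\<omega> [^]\<^bsub>BijGroup B\<^esub> k \<in> carrier (BijGroup B)" using assms(1) by simp
    have "\<omega> b \<in> B" using assms(1) Suc.prems Bij_imp_funcset by (auto simp: BijGroup_def)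
    have mult: "(f \<otimes>\<^bsub>BijGroup B\<^esub> g) b = f (g b)"
      if "f \<in> carrier (BijGroup B)" "g \<in> carrier (BijGroup B)" for f g
      using that Suc.prems by (simp add: BijGroup_def compose_def)
    have "(\<omega> [^]\<^bsub>BijGroup B\<^esub> Suc k) b = (\<omega> [^]\<^bsub>BijGroup B\<^esub> k) (\<omega> b)"
      unfolding nat_pow_Suc using c assms(1) by (rule mult)
    also have "\<dots> = (\<omega> ^^ Suc k) b"
      unfolding funpow_Suc_right o_apply using \<open>\<omega> b \<in> B\<close> by (rule Suc.IH)
    finally show ?case .
  qed
qed

text \<open>An element of \<open>BijGroup B\<close> is extensional, hence it is the unit as soon as it fixes \<open>B\<close>
pointwise.\<close>
lemma has_order_BijGroup:
  assumes "\<omega> \<in> carrier (BijGroup B)"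
  shows "has_order B \<omega> (group.ord (BijGroup B) \<omega>)"
proof -
  interpret group "BijGroup B" by (rule group_BijGroup)
  have one_iff: "f = \<one>\<^bsub>BijGroup B\<^esub> \<longleftrightarrow> (\<forall>b\<in>B. f b = b)" if "f \<in> carrier (BijGroup B)" for f
    using that by (auto simp: BijGroup_def Bij_def intro!: extensionalityI[of _ B])
  have "(\<forall>b\<in>B. (\<omega> ^^ k) b = b) \<longleftrightarrow> \<omega> [^]\<^bsub>BijGroup B\<^esub> k = \<one>\<^bsub>BijGroup B\<^esub>" for k
    using one_iff[OF nat_pow_closed[OF assms, of k]] BijGroup_nat_pow_apply[OF assms, of _ k] by simp
  then show ?thesis unfolding has_order_def using pow_eq_id[OF assms] by simp
qed

text \<open>The larger degree \<open>N\<close> is harmless because \<open>p\<close> fixes everything outside \<open>{1..n}\<close>; it allows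
\<open>p\<close> to be regarded as an element of a larger symmetric group without changing its order.\<close>
lemma has_order_sym_group:
  assumes "p permutes {1..n}" "n \<le> N"
  shows "has_order {1..N} p (group.ord (sym_group n) p)"
proof -
  interpret group "sym_group n" by (rule sym_group_is_group)
  have pow: "p [^]\<^bsub>sym_group n\<^esub> k = p ^^ k" for k :: nat
    by (induction k) (simp_all add: sym_group_mult sym_group_one funpow_Suc_right del: funpow.simps(2))
  have "(\<forall>b\<in>{1..N}. (p ^^ k) b = b) \<longleftrightarrow> p [^]\<^bsub>sym_group n\<^esub> k = \<one>\<^bsub>sym_group n\<^esub>" for k
  proof -
    have "(p ^^ k) permutes {1..N}"
      using permutes_funpow[OF permutes_subset[OF assms(1)], of "{1..N}"] assms(2) by auto
    then show ?thesis unfolding pow sym_group_one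
      by (metis eq_id_iff permutes_not_in)
  qed
  then show ?thesis unfolding has_order_def
    using pow_eq_id[of p] assms(1) by (simp add: sym_group_carrier)
qed

lemma sym_group_ord_bounds:
  assumes "p permutes {1..n}"
  shows "0 < group.ord (sym_group n) p" "group.ord (sym_group n) p \<le> landau n"
proof -
  interpret group "sym_group n" by (rule sym_group_is_group)
  have fin: "finite (carrier (sym_group n))"
    using finite_permutations[of "{1..n}"] by (simp add: sym_group_def)
  show "0 < group.ord (sym_group n) p"
    using ord_ge_1[OF fin] assms by (auto simp: sym_group_carrier Suc_le_eq)
  show "group.ord (sym_group n) p \<le> landau n"
    unfolding landau_def using fin assms by (auto intro!: Max_ge simp: sym_group_carrier)
qed

lemma landau_attained: "\<exists>p. p permutes {1..n} \<and> group.ord (sym_group n) p = landau n"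
proof -
  interpret group "sym_group n" by (rule sym_group_is_group)
  have fin: "finite (carrier (sym_group n))"
    using finite_permutations[of "{1..n}"] by (simp add: sym_group_def)
  have "landau n \<in> group.ord (sym_group n) ` carrier (sym_group n)"
    unfolding landau_def using fin by (intro Max_in) (auto intro: one_closed)
  then show ?thesis by (auto simp: sym_group_carrier)
qed

lemma landau_mono: assumes "d \<le> n" shows "landau d \<le> landau n"
proof -
  obtain p where p: "p permutes {1..d}" "group.ord (sym_group d) p = landau d"
    using landau_attained by blast
  then have pn: "p permutes {1..n}" using assms permutes_subset by fastforce
  have "group.ord (sym_group d) p = group.ord (sym_group n) p"
    using has_order_unique has_order_sym_group[OF p(1) assms] has_order_sym_group[OF pn] by blast
  then show ?thesis using sym_group_ord_bounds(2)[OF pn] p(2) by simp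
qed

section \<open>Conjugacy classes of symmetric groups\<close>

lemma (in group) conj_class_subset:
  assumes "x \<in> carrier G" "y \<in> carrier G" "h \<in> carrier G" "h \<otimes> x = y \<otimes> h"
  shows "conj_class G y \<subseteq> conj_class G x"
proof
  fix z assume "z \<in> conj_class G y"
  then obtain k where k: "k \<in> carrier G" "z = k \<otimes> y \<otimes> inv k"
    by (auto simp: conj_class_def)
  have "y = h \<otimes> x \<otimes> inv h" using assms by (simp add: inv_solve_right)
  then have "z = (k \<otimes> h) \<otimes> x \<otimes> inv (k \<otimes> h)"
    using assms(1-3) k by (simp add: inv_mult_group m_assoc)
  then show "z \<in> conj_class G x" using assms(3) k(1) unfolding conj_class_def by blast
qed

lemma (in group) conj_class_eq_iff:
  assumes "x \<in> carrier G" "y \<in> carrier G"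
  shows "conj_class G x = conj_class G y \<longleftrightarrow> (\<exists>h\<in>carrier G. h \<otimes> x = y \<otimes> h)"
proof
  assume "conj_class G x = conj_class G y"
  moreover have "y \<in> conj_class G y"
    using assms(2) by (auto simp: conj_class_def intro!: exI[of _ \<one>])
  ultimately obtain h where h: "h \<in> carrier G" "y = h \<otimes> x \<otimes> inv h"
    by (auto simp: conj_class_def)
  then have "h \<otimes> x = y \<otimes> h" using assms by (simp add: m_assoc)
  then show "\<exists>h\<in>carrier G. h \<otimes> x = y \<otimes> h" using h(1) by blast
next
  assume "\<exists>h\<in>carrier G. h \<otimes> x = y \<otimes> h"
  then obtain h where h: "h \<in> carrier G" "h \<otimes> x = y \<otimes> h" by blast
  have "inv h \<otimes> y = inv h \<otimes> (y \<otimes> h) \<otimes> inv h" using h(1) assms by (simp add: m_assoc)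
  also have "\<dots> = x \<otimes> inv h" using h(1) assms by (simp flip: h(2) add: m_assoc[symmetric])
  finally show "conj_class G x = conj_class G y"
    using conj_class_subset[OF assms h] conj_class_subset[OF assms(2,1), of "inv h"] h(1) by simp
qed

text \<open>An isomorphism of solutions yields only a bijection of \<open>{1..n}\<close>, with unknown values elsewhere.
Replacing these values by those of the identity turns it into an element of the symmetric group.\<close>
lemma conj_class_sym_group_eq_iff:
  assumes "p permutes {1..n}" "q permutes {1..n}"
  shows "conj_class (sym_group n) p = conj_class (sym_group n) q \<longleftrightarrow>
    (\<exists>h. bij_betw h {1..n} {1..n} \<and> (\<forall>b\<in>{1..n}. h (p b) = q (h b)))"
proof -
  have "conj_class (sym_group n) p = conj_class (sym_group n) q \<longleftrightarrow>
      (\<exists>h. h permutes {1..n} \<and> h \<circ> p = q \<circ> h)"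
    using group.conj_class_eq_iff[OF sym_group_is_group, of p n q] assms
    by (auto simp: sym_group_carrier sym_group_mult)
  also have "\<dots> \<longleftrightarrow> (\<exists>h. bij_betw h {1..n} {1..n} \<and> (\<forall>b\<in>{1..n}. h (p b) = q (h b)))"
  proof
    assume "\<exists>h. h permutes {1..n} \<and> h \<circ> p = q \<circ> h"
    then show "\<exists>h. bij_betw h {1..n} {1..n} \<and> (\<forall>b\<in>{1..n}. h (p b) = q (h b))"
      using permutes_imp_bij by (metis o_apply)
  next
    assume "\<exists>h. bij_betw h {1..n} {1..n} \<and> (\<forall>b\<in>{1..n}. h (p b) = q (h b))"
    then obtain h where h: "bij_betw h {1..n} {1..n}" "\<forall>b\<in>{1..n}. h (p b) = q (h b)" by blast
    define h' where "h' b = (if b \<in> {1..n} then h b else b)" for b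
    have "bij_betw h' {1..n} {1..n}"
      using h(1) by (rule bij_betw_cong[THEN iffD1, rotated]) (simp add: h'_def)
    then have perm: "h' permutes {1..n}" by (rule bij_imp_permutes) (auto simp: h'_def)
    have "h' (p b) = q (h' b)" for b
      using h(2) permutes_in_image[OF assms(1), of b] permutes_not_in[OF assms(1), of b]
        permutes_not_in[OF assms(2), of b]
      by (cases "b \<in> {1..n}") (simp_all only: h'_def if_True if_False simp_thms)
    then show "\<exists>h. h permutes {1..n} \<and> h \<circ> p = q \<circ> h" using perm by (metis o_apply ext)
  qed
  finally show ?thesis .
qed

lemma sym_group_ord_conj_invariant:
  assumes "p permutes {1..n}" "q permutes {1..n}"
    "conj_class (sym_group n) p = conj_class (sym_group n) q"
  shows "group.ord (sym_group n) p = group.ord (sym_group n) q"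
proof -
  obtain h where h: "bij_betw h {1..n} {1..n}" "\<forall>b\<in>{1..n}. h (p b) = q (h b)"
    using assms conj_class_sym_group_eq_iff by blast
  have "p \<in> {1..n} \<rightarrow> {1..n}" using permutes_in_image[OF assms(1)] by blast
  then show ?thesis
    using has_order_conj[OF _ h] has_order_sym_group[OF assms(1)] has_order_sym_group[OF assms(2)]
      has_order_unique by blast
qed

text \<open>Conjugate permutations have the same order, which lies between \<open>1\<close> and the Landau number, so
sorting the conjugacy classes by order neither loses nor repeats any.\<close>
lemma card_conj_classes_sym_group:
  "card (conj_class (sym_group n) ` {p. p permutes {1..n}}) =
    (\<Sum>k = 1..landau n. num_conj_classes n k)"
proof -
  let ?P = "\<lambda>k. {p. p permutes {1..n} \<and> group.ord (sym_group n) p = k}"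
  have "{p. p permutes {1..n}} = (\<Union>k\<in>{1..landau n}. ?P k)"
    using sym_group_ord_bounds by (force simp: Suc_le_eq)
  then have un: "conj_class (sym_group n) ` {p. p permutes {1..n}} =
      (\<Union>k\<in>{1..landau n}. conj_class (sym_group n) ` ?P k)" by blast
  have fin: "finite (conj_class (sym_group n) ` ?P k)" for k
    by (intro finite_imageI finite_subset[OF _ finite_permutations[of "{1..n}"]]) auto
  have disj: "conj_class (sym_group n) ` ?P k \<inter> conj_class (sym_group n) ` ?P l = {}"
    if "k \<noteq> l" for k l
  proof (rule ccontr)
    assume "\<not> ?thesis"
    then obtain p q where "p \<in> ?P k" "q \<in> ?P l"
      "conj_class (sym_group n) p = conj_class (sym_group n) q" by blast
    then show False using that sym_group_ord_conj_invariant[of p n q] by simp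
  qed
  have "card (\<Union>k\<in>{1..landau n}. conj_class (sym_group n) ` ?P k) =
      (\<Sum>k = 1..landau n. card (conj_class (sym_group n) ` ?P k))"
    by (rule card_UN_disjoint[OF finite_atLeastAtMost]) (intro ballI impI fin disj, assumption?)+
  then show ?thesis unfolding un by (simp add: num_conj_classes_def sym_group_carrier)
qed

section \<open>Isomorphisms of maps on pairs\<close>

text \<open>In terms of pairs, an isomorphism of solutions is a conjugation of self-maps; this is the form
to which \<open>has_order_conj\<close> applies.\<close>
lemma isomorphic_intertwines:
  assumes "isomorphic X R X' R'" "R \<in> X \<times> X \<rightarrow> X \<times> X"
  shows "\<exists>s. bij_betw s (X \<times> X) (X' \<times> X') \<and> (\<forall>p\<in>X \<times> X. s (R p) = R' (s p))"
proof -
  from assms(1) obtain \<sigma> where \<sigma>: "bij_betw \<sigma> X X'"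
    "\<forall>p \<in> X \<times> X. (map_prod \<sigma> \<sigma> \<circ> R) p = (R' \<circ> map_prod \<sigma> \<sigma>) p"
    unfolding isomorphic_def by blast
  show ?thesis using bij_betw_map_prod[OF \<sigma>(1) \<sigma>(1)] \<sigma>(2)
    by (intro exI[of _ "map_prod \<sigma> \<sigma>"]) auto
qed

lemma isomorphic_has_order:
  assumes "isomorphic X R X' R'" "R \<in> X \<times> X \<rightarrow> X \<times> X"
  shows "has_order (X \<times> X) R m \<longleftrightarrow> has_order (X' \<times> X') R' m"
  using isomorphic_intertwines[OF assms] has_order_conj[OF assms(2)] by blast

lemma isomorphic_sym:
  assumes "isomorphic X R X' R'" "R \<in> X \<times> X \<rightarrow> X \<times> X"
  shows "isomorphic X' R' X R"
proof -
  from assms(1) obtain \<sigma> where \<sigma>: "bij_betw \<sigma> X X'"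
    "\<forall>p \<in> X \<times> X. (map_prod \<sigma> \<sigma> \<circ> R) p = (R' \<circ> map_prod \<sigma> \<sigma>) p"
    unfolding isomorphic_def by blast
  define \<tau> where "\<tau> = inv_into X \<sigma>"
  have \<tau>: "bij_betw \<tau> X' X" "\<And>x. x \<in> X' \<Longrightarrow> \<sigma> (\<tau> x) = x" "\<And>x. x \<in> X \<Longrightarrow> \<tau> (\<sigma> x) = x"
    using \<sigma>(1) unfolding \<tau>_def
    by (auto simp: bij_betw_inv_into bij_betw_inv_into_left bij_betw_inv_into_right)
  have "map_prod \<tau> \<tau> (R' (x, y)) = R (\<tau> x, \<tau> y)" if "x \<in> X'" "y \<in> X'" for x y
  proof -
    have t: "\<tau> x \<in> X" "\<tau> y \<in> X" using that \<tau>(1) by (auto simp: bij_betw_def)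
    then have "R' (x, y) = map_prod \<sigma> \<sigma> (R (\<tau> x, \<tau> y))"
      using \<sigma>(2) \<tau>(2) that by force
    moreover have "R (\<tau> x, \<tau> y) \<in> X \<times> X" using assms(2) t by auto
    ultimately show ?thesis using \<tau>(3) by (cases "R (\<tau> x, \<tau> y)") auto
  qed
  then show ?thesis unfolding isomorphic_def using \<tau>(1) by (intro exI[of _ \<tau>]) auto
qed

lemma isomorphic_trans:
  assumes "isomorphic X R Y S" "isomorphic Y S Z T" "R \<in> X \<times> X \<rightarrow> X \<times> X"
  shows "isomorphic X R Z T"
proof -
  from assms(1) obtain \<sigma> where \<sigma>: "bij_betw \<sigma> X Y"
    "\<forall>p \<in> X \<times> X. (map_prod \<sigma> \<sigma> \<circ> R) p = (S \<circ> map_prod \<sigma> \<sigma>) p"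
    unfolding isomorphic_def by blast
  from assms(2) obtain \<tau> where \<tau>: "bij_betw \<tau> Y Z"
    "\<forall>p \<in> Y \<times> Y. (map_prod \<tau> \<tau> \<circ> S) p = (T \<circ> map_prod \<tau> \<tau>) p"
    unfolding isomorphic_def by blast
  have "map_prod (\<tau> \<circ> \<sigma>) (\<tau> \<circ> \<sigma>) (R p) = T (map_prod (\<tau> \<circ> \<sigma>) (\<tau> \<circ> \<sigma>) p)"
    if "p \<in> X \<times> X" for p
  proof -
    have "map_prod \<sigma> \<sigma> p \<in> Y \<times> Y" using that \<sigma>(1) by (auto simp: bij_betw_def)
    then have "map_prod \<tau> \<tau> (S (map_prod \<sigma> \<sigma> p)) = T (map_prod \<tau> \<tau> (map_prod \<sigma> \<sigma> p))"
      using bspec[OF \<tau>(2)] by simp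
    then show ?thesis using bspec[OF \<sigma>(2) that] by (simp flip: map_prod.comp)
  qed
  then show ?thesis unfolding isomorphic_def using bij_betw_trans[OF \<sigma>(1) \<tau>(1)]
    by (intro exI[of _ "\<tau> \<circ> \<sigma>"]) auto
qed

section \<open>Surjective solutions come from rectangular bands\<close>

lemma FS_solution_iff:
  "FS_solution X (\<lambda>(x, y). (f x y, g x y)) \<longleftrightarrow>
    (\<forall>x\<in>X. \<forall>y\<in>X. f x y \<in> X \<and> g x y \<in> X) \<and>
    (\<forall>x\<in>X. \<forall>y\<in>X. \<forall>z\<in>X.
       f x (f y z) = f x z \<and> f (f x y) z = f x z \<and>
       g x (f y z) = g x y \<and> f y (g x z) = g x y \<and>
       g y (g x z) = g y z \<and> g (f x y) z = g y z)"
    (is "FS_solution X ?R \<longleftrightarrow> ?closed \<and> ?eqs")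
proof -
  have "(R12 ?R \<circ> R23 ?R) t = (R23 ?R \<circ> R13 ?R) t \<and> (R23 ?R \<circ> R13 ?R) t = (R13 ?R \<circ> R12 ?R) t \<longleftrightarrow>
      f x (f y z) = f x z \<and> f (f x y) z = f x z \<and>
      g x (f y z) = g x y \<and> f y (g x z) = g x y \<and>
      g y (g x z) = g y z \<and> g (f x y) z = g y z"
    if "t = (x, y, z)" for t x y z
    unfolding that R12_def R13_def R23_def by auto
  moreover have "?R \<in> X \<times> X \<rightarrow> X \<times> X \<longleftrightarrow> ?closed" by (simp add: Pi_iff)
  ultimately show ?thesis unfolding FS_solution_def by simp
qed

text \<open>The identities that characterize a solution are stable under relabelling the elements.\<close>
lemma transport_solution:
  assumes "bij_betw \<sigma> X X'" "FS_solution X' R'"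
  shows "\<exists>R. FS_solution X R \<and> isomorphic X R X' R'"
proof -
  define f' g' where "f' = (\<lambda>x y. fst (R' (x, y)))" and "g' = (\<lambda>x y. snd (R' (x, y)))"
  have R': "R' = (\<lambda>(x, y). (f' x y, g' x y))" by (auto simp: f'_def g'_def)
  note FS = assms(2)[unfolded R' FS_solution_iff]
  define \<tau> where "\<tau> = inv_into X \<sigma>"
  have \<sigma>: "\<sigma> x \<in> X'" if "x \<in> X" for x using that assms(1) by (auto simp: bij_betw_def)
  have \<tau>: "\<tau> y \<in> X" "\<sigma> (\<tau> y) = y" if "y \<in> X'" for y
    using that assms(1) unfolding \<tau>_def
    by (auto simp: bij_betw_inv_into_right bij_betw_def inv_into_into f_inv_into_f)
  let ?R = "\<lambda>(x, y). (\<tau> (f' (\<sigma> x) (\<sigma> y)), \<tau> (g' (\<sigma> x) (\<sigma> y)))"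
  have "FS_solution X ?R"
    unfolding FS_solution_iff using FS by (simp add: \<sigma> \<tau>)
  moreover have "isomorphic X ?R X' R'"
    unfolding isomorphic_def using assms(1) FS by (intro exI[of _ \<sigma>]) (auto simp: R' \<sigma> \<tau>)
  ultimately show ?thesis by blast
qed

text \<open>The coordinates of the rectangular band \<open>f\<close> are read off at a base point \<open>e\<close>: the map
\<open>x \<mapsto> (f x e, f e x)\<close> is injective, since \<open>f (f x e) (f e x) = f x x = x\<close>. Both coordinate sets
are subsets of \<open>X\<close>, which is why \<open>A\<close> and \<open>B\<close> can be found in the type of \<open>X\<close>.\<close>
lemma surjective_solution_isomorphic_R_perm:
  fixes X :: "'a set"
  assumes "X \<noteq> {}" "FS_solution X R" "X \<times> X \<subseteq> R ` (X \<times> X)"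
  shows "\<exists>(A :: 'a set) (B :: 'a set) \<omega>. A \<noteq> {} \<and> B \<noteq> {} \<and> \<omega> \<in> B \<rightarrow> B \<and>
           isomorphic X R (A \<times> B) (R_perm \<omega>)"
proof -
  define f g where "f = (\<lambda>x y. fst (R (x, y)))" and "g = (\<lambda>x y. snd (R (x, y)))"
  have R: "R = (\<lambda>(x, y). (f x y, g x y))" by (auto simp: f_def g_def)
  note FS = assms(2)[unfolded R FS_solution_iff]
  have cl: "f x y \<in> X" "g x y \<in> X" if "x \<in> X" "y \<in> X" for x y
    using FS that by blast+
  have eqs: "f x (f y z) = f x z" "f (f x y) z = f x z" "g x (f y z) = g x y"
      "f y (g x z) = g x y" "g y (g x z) = g y z" "g (f x y) z = g y z"
    if "x \<in> X" "y \<in> X" "z \<in> X" for x y z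
    using FS that by blast+
  \<comment> \<open>Idempotence comes from surjectivity: if \<open>x = f u v\<close>, then both absorption laws turn
    \<open>f (f u v) (f u v)\<close> into \<open>f u v\<close>.\<close>
  have idem: "f x x = x" if "x \<in> X" for x
  proof -
    have "(x, x) \<in> R ` (X \<times> X)" using that assms(3) by blast
    then obtain u v where "u \<in> X" "v \<in> X" "x = f u v" by (auto simp: R)
    then show ?thesis using eqs cl by metis
  qed
  obtain e where e: "e \<in> X" using assms(1) by blast
  define A B where "A = (\<lambda>x. f x e) ` X" and "B = (\<lambda>x. f e x) ` X"
  \<comment> \<open>By \<open>f e (g x y) = g x e\<close>, the second coordinate of \<open>g x y\<close> is \<open>g x e\<close>, which depends on
    \<open>x\<close> only through \<open>f e x\<close>.\<close>
  define \<omega> where "\<omega> b = g b e" for b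
  define \<sigma> where "\<sigma> x = (f x e, f e x)" for x
  have "f (f x e) (f e x) = x" if "x \<in> X" for x
    using that e eqs cl idem by metis
  then have "inj_on \<sigma> X" unfolding \<sigma>_def by (intro inj_onI) (metis prod.inject)
  moreover have "\<sigma> ` X = A \<times> B"
  proof (intro equalityI subsetI)
    fix p assume "p \<in> A \<times> B"
    then obtain x y where xy: "x \<in> X" "y \<in> X" "p = (f x e, f e y)" by (auto simp: A_def B_def)
    then have "p = \<sigma> (f x y)" using eqs e by (simp add: \<sigma>_def)
    then show "p \<in> \<sigma> ` X" using cl xy by blast
  qed (auto simp: \<sigma>_def A_def B_def)
  ultimately have bij: "bij_betw \<sigma> X (A \<times> B)" by (simp add: bij_betw_def)
  have \<sigma>f: "\<sigma> (f x y) = (f x e, f e y)" if "x \<in> X" "y \<in> X" for x y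
    using that e eqs by (simp add: \<sigma>_def)
  have \<sigma>g: "\<sigma> (g x y) = (f y e, \<omega> (f e x))" if "x \<in> X" "y \<in> X" for x y
  proof -
    have "f (g x y) e = f (f y (g x y)) e" using that eqs(4) by simp
    also have "\<dots> = f y e" using that e cl eqs(2) by simp
    finally show ?thesis using that e eqs cl by (simp add: \<sigma>_def \<omega>_def)
  qed
  have iso: "isomorphic X R (A \<times> B) (R_perm \<omega>)"
    unfolding isomorphic_def
  proof (intro exI[of _ \<sigma>] conjI ballI bij)
    fix p assume "p \<in> X \<times> X"
    then show "(map_prod \<sigma> \<sigma> \<circ> R) p = (R_perm \<omega> \<circ> map_prod \<sigma> \<sigma>) p"
      by (cases p) (simp add: R R_perm_def \<sigma>f \<sigma>g, simp add: \<sigma>_def)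
  qed
  have "\<omega> b \<in> B" if "b \<in> B" for b
  proof -
    from that have "b \<in> X" using e cl by (auto simp: B_def)
    moreover from this have "\<omega> b = f e (g b e)" using e eqs(4) by (simp add: \<omega>_def)
    ultimately show ?thesis using cl e by (simp add: B_def)
  qed
  then show ?thesis using iso assms(1)
    by (intro exI[of _ A] exI[of _ B] exI[of _ \<omega>]) (auto simp: A_def B_def)
qed

section \<open>The solutions attached to a permutation\<close>

lemma R_perm_closed: "\<omega> \<in> B \<rightarrow> B \<Longrightarrow> R_perm \<omega> \<in> (A \<times> B) \<times> (A \<times> B) \<rightarrow> (A \<times> B) \<times> (A \<times> B)"
  by (auto simp: R_perm_def)

lemma R_perm_FS_solution:
  fixes A :: "'a set" and B :: "'b set"
  assumes "\<omega> \<in> B \<rightarrow> B"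
  shows "FS_solution (A \<times> B) (R_perm \<omega>)"
proof -
  have "FS_solution (A \<times> B) (\<lambda>(x, y). ((fst x, snd y), (fst y, \<omega> (snd x))))"
    unfolding FS_solution_iff using assms by auto
  moreover have "(R_perm \<omega> :: ('a \<times> 'b) \<times> ('a \<times> 'b) \<Rightarrow> _) = (\<lambda>(x, y). ((fst x, snd y), (fst y, \<omega> (snd x))))"
    by (auto simp: R_perm_def)
  ultimately show ?thesis by simp
qed

lemma R_perm_funpow_even:
  "(R_perm \<omega> ^^ (2 * j)) ((a, b), (a', b')) = ((a, (\<omega> ^^ j) b), (a', (\<omega> ^^ j) b'))"
  by (induction j) (auto simp: R_perm_def)

lemma R_perm_funpow_odd:
  "(R_perm \<omega> ^^ Suc (2 * j)) ((a, b), (a', b')) = ((a, (\<omega> ^^ j) b'), (a', (\<omega> ^^ Suc j) b))"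
  unfolding funpow.simps o_apply R_perm_funpow_even by (simp add: R_perm_def)

text \<open>Even powers reduce to powers of \<open>\<omega>\<close>. If an odd power were the identity, comparing first
entries would give \<open>(\<omega> ^^ j) b = b'\<close> for all \<open>b\<close> and \<open>b'\<close> in \<open>B\<close>, which is absurd unless \<open>B\<close>
has only one element; in that case \<open>R_perm \<omega>\<close> is the identity.\<close>
lemma has_order_R_perm:
  assumes "A \<noteq> {}" "B \<noteq> {}" "\<omega> \<in> B \<rightarrow> B" "has_order B \<omega> m"
  shows "has_order ((A \<times> B) \<times> (A \<times> B)) (R_perm \<omega>) (if is_singleton B then 1 else 2 * m)"
proof (cases "is_singleton B")
  case True
  then obtain b where B: "B = {b}" by (auto elim: is_singletonE)
  then have "\<forall>p \<in> (A \<times> B) \<times> (A \<times> B). R_perm \<omega> p = p"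
    using assms(3) by (auto simp: R_perm_def)
  then have "(R_perm \<omega> ^^ k) p = p" if "p \<in> (A \<times> B) \<times> (A \<times> B)" for p k
    using that by (induction k) auto
  then show ?thesis using True by (auto simp: has_order_def)
next
  case False
  then obtain b c where bc: "b \<in> B" "c \<in> B" "b \<noteq> c"
    using assms(2) by (metis is_singletonI')
  obtain a where a: "a \<in> A" using assms(1) by blast
  have "(\<forall>p\<in>(A \<times> B) \<times> (A \<times> B). (R_perm \<omega> ^^ k) p = p) \<longleftrightarrow> 2 * m dvd k" for k
  proof (cases "even k")
    case True
    then obtain j where k: "k = 2 * j" by (elim evenE)
    have "(\<forall>p\<in>(A \<times> B) \<times> (A \<times> B). (R_perm \<omega> ^^ k) p = p) \<longleftrightarrow> (\<forall>b\<in>B. (\<omega> ^^ j) b = b)"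
      using a by (auto simp: k R_perm_funpow_even)
    then show ?thesis using assms(4) by (simp add: has_order_def k)
  next
    case False
    then obtain j where k: "k = Suc (2 * j)" by (auto elim: oddE)
    have "\<exists>p\<in>(A \<times> B) \<times> (A \<times> B). (R_perm \<omega> ^^ k) p \<noteq> p"
    proof (rule ccontr)
      assume *: "\<not> ?thesis"
      have "(\<omega> ^^ j) b = b'" if "b' \<in> B" for b'
      proof -
        have "(R_perm \<omega> ^^ k) ((a, b'), (a, b)) = ((a, b'), (a, b))" using * a bc that by auto
        then show ?thesis unfolding k R_perm_funpow_odd by simp
      qed
      then show False using bc by metis
    qed
    then show ?thesis using False by (meson dvd_mult_left)
  qed
  then show ?thesis using False by (simp add: has_order_def)
qed

lemma isomorphic_R_perm_order:
  assumes "isomorphic X R (A \<times> B) (R_perm \<omega>)" "R \<in> X \<times> X \<rightarrow> X \<times> X"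
    and "A \<noteq> {}" "B \<noteq> {}" "\<omega> \<in> B \<rightarrow> B" "has_order B \<omega> m" "0 < m"
  shows "finite_order X R" "map_order X R = (if is_singleton B then 1 else 2 * m)"
proof -
  have "has_order (X \<times> X) R (if is_singleton B then 1 else 2 * m)"
    using isomorphic_has_order[OF assms(1,2)] has_order_R_perm[OF assms(3-6)] by simp
  from has_order_map_order[OF this] assms(7)
  show "finite_order X R" "map_order X R = (if is_singleton B then 1 else 2 * m)" by auto
qed

lemma isomorphic_R_perm_cong:
  assumes "bij_betw \<alpha> A A'" "bij_betw h B B'" "\<forall>b\<in>B. h (p b) = q (h b)"
  shows "isomorphic (A \<times> B) (R_perm p) (A' \<times> B') (R_perm q)"
  unfolding isomorphic_def using bij_betw_map_prod[OF assms(1,2)] assms(3)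
  by (intro exI[of _ "map_prod \<alpha> h"]) (auto simp: R_perm_def)

text \<open>The first entry of \<open>R_perm p ((a, b), (a', b'))\<close> is \<open>(a, b')\<close>, so an isomorphism \<open>\<sigma>\<close> takes
\<open>(a, b')\<close> to the pair of the first coordinate of \<open>\<sigma> (a, b)\<close> and the second coordinate of
\<open>\<sigma> (a', b')\<close>. Hence the second coordinate of \<open>\<sigma> (a, b)\<close> is a function \<open>h b\<close> of \<open>b\<close> alone, and
the second entries of the values show that \<open>h\<close> intertwines \<open>p\<close> and \<open>q\<close>.\<close>
lemma isomorphic_R_perm_imp_conj:
  assumes "isomorphic (A \<times> B) (R_perm p) (A' \<times> B') (R_perm q)" "A \<noteq> {}" "B \<noteq> {}"
  shows "\<exists>h. bij_betw h B B' \<and> (\<forall>b\<in>B. h (p b) = q (h b))"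
proof -
  from assms(1) obtain \<sigma> where \<sigma>: "bij_betw \<sigma> (A \<times> B) (A' \<times> B')"
    "\<forall>x \<in> (A \<times> B) \<times> (A \<times> B). (map_prod \<sigma> \<sigma> \<circ> R_perm p) x = (R_perm q \<circ> map_prod \<sigma> \<sigma>) x"
    unfolding isomorphic_def by blast
  have eq: "\<sigma> (a, b') = (fst (\<sigma> (a, b)), snd (\<sigma> (a', b')))"
      "\<sigma> (a', p b) = (fst (\<sigma> (a', b')), q (snd (\<sigma> (a, b))))"
    if "a \<in> A" "b \<in> B" "a' \<in> A" "b' \<in> B" for a b a' b'
    using \<sigma>(2)[rule_format, of "((a, b), (a', b'))"] that
    by (auto simp: R_perm_def split: prod.splits)
  obtain a where a: "a \<in> A" using assms(2) by blast
  define h where "h b = snd (\<sigma> (a, b))" for b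
  have "inj_on h B"
  proof (rule inj_onI)
    fix b c assume bc: "b \<in> B" "c \<in> B" "h b = h c"
    then have "\<sigma> (a, b) = \<sigma> (a, c)" using eq(1)[of a c a b] a by (simp add: h_def prod_eq_iff)
    then show "b = c" using \<sigma>(1) a bc by (auto simp: bij_betw_def inj_on_def)
  qed
  moreover have "h ` B = B'"
  proof (intro equalityI subsetI)
    fix b' assume b': "b' \<in> h ` B"
    then show "b' \<in> B'" using \<sigma>(1) a
      by (auto simp: h_def bij_betw_def) (metis SigmaI imageI mem_Sigma_iff prod.collapse)
  next
    fix b' assume b': "b' \<in> B'"
    obtain b where b: "b \<in> B" using assms(3) by blast
    have "(fst (\<sigma> (a, b)), b') \<in> \<sigma> ` (A \<times> B)"
      using \<sigma>(1) a b b' by (auto simp: bij_betw_def) (metis SigmaI imageI mem_Sigma_iff prod.collapse)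
    then obtain a' c where "a' \<in> A" "c \<in> B" "\<sigma> (a', c) = (fst (\<sigma> (a, b)), b')" by auto
    then have "h c = b'" using eq(1)[of a b a' c] a b by (simp add: h_def)
    then show "b' \<in> h ` B" using \<open>c \<in> B\<close> by blast
  qed
  ultimately have "bij_betw h B B'" by (simp add: bij_betw_def)
  moreover have "h (p b) = q (h b)" if "b \<in> B" for b
    using eq(2)[of a b a b] a that by (simp add: h_def)
  ultimately show ?thesis by blast
qed

section \<open>Solutions of finite order\<close>

text \<open>If \<open>R ^^ k\<close> is the identity, then so is \<open>R ^^ (2 * k)\<close>, which corresponds to \<open>\<omega> ^^ k\<close> on both
\<open>B\<close>-coordinates. Therefore \<open>\<omega>\<close> has finite order, and in particular it is a bijection.\<close>
lemma finite_order_solution_isomorphic_R_perm: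
  fixes X :: "'a set"
  assumes "X \<noteq> {}" "FS_solution X R" "finite_order X R"
  shows "\<exists>(A :: 'a set) (B :: 'a set) \<omega>. A \<noteq> {} \<and> B \<noteq> {} \<and> \<omega> \<in> carrier (BijGroup B) \<and>
           0 < group.ord (BijGroup B) \<omega> \<and> isomorphic X R (A \<times> B) (R_perm \<omega>)"
proof -
  have cl: "R \<in> X \<times> X \<rightarrow> X \<times> X" using assms(2) by (simp add: FS_solution_def)
  obtain k where k: "0 < k" "\<forall>p\<in>X \<times> X. (R ^^ k) p = p"
    using assms(3) by (auto simp: finite_order_def)
  have "X \<times> X \<subseteq> R ` (X \<times> X)" using bij_betw_if_funpow_id[OF cl k] by (simp add: bij_betw_def)
  from surjective_solution_isomorphic_R_perm[OF assms(1,2) this]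
  obtain A B :: "'a set" and \<omega> where AB: "A \<noteq> {}" "B \<noteq> {}" "\<omega> \<in> B \<rightarrow> B"
      "isomorphic X R (A \<times> B) (R_perm \<omega>)" by blast
  obtain a where a: "a \<in> A" using AB(1) by blast
  obtain s where s: "bij_betw s (X \<times> X) ((A \<times> B) \<times> A \<times> B)"
      "\<forall>p\<in>X \<times> X. s (R p) = R_perm \<omega> (s p)"
    using isomorphic_intertwines[OF AB(4) cl] by blast
  have "\<forall>p\<in>X \<times> X. (R ^^ (2 * k)) p = p"
    using k(2) by (simp add: mult_2 funpow_add)
  then have "\<forall>p\<in>(A \<times> B) \<times> (A \<times> B). (R_perm \<omega> ^^ (2 * k)) p = p"
    using funpow_fixes_conj[OF cl s] by blast
  then have \<omega>k: "\<forall>b\<in>B. (\<omega> ^^ k) b = b" using a by (auto simp: R_perm_funpow_even)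
  \<comment> \<open>Membership in \<open>BijGroup B\<close> requires an extensional map.\<close>
  define \<omega>' where "\<omega>' = restrict \<omega> B"
  have "bij_betw \<omega>' B B"
    using bij_betw_if_funpow_id[OF AB(3) k(1) \<omega>k] by (rule bij_betw_cong[THEN iffD1, rotated]) (simp add: \<omega>'_def)
  then have c: "\<omega>' \<in> carrier (BijGroup B)" by (simp add: BijGroup_def Bij_def \<omega>'_def)
  have "has_order B \<omega> m \<longleftrightarrow> has_order B \<omega>' m" for m
    using has_order_conj[OF AB(3), of id B \<omega>'] by (auto simp: \<omega>'_def)
  then have "has_order B \<omega> (group.ord (BijGroup B) \<omega>')" using has_order_BijGroup[OF c] by simp
  then have "0 < group.ord (BijGroup B) \<omega>'" using \<omega>k k(1) by (auto simp: has_order_def intro: dvd_pos_nat)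
  moreover have "isomorphic X R (A \<times> B) (R_perm \<omega>')"
  proof (rule isomorphic_trans[OF AB(4) _ cl])
    show "isomorphic (A \<times> B) (R_perm \<omega>) (A \<times> B) (R_perm \<omega>')"
      by (rule isomorphic_R_perm_cong[of id _ _ id]) (auto simp: \<omega>'_def)
  qed
  ultimately show ?thesis using AB(1,2) c by blast
qed

text \<open>An order of at least \<open>2\<close> excludes a one-element set \<open>B\<close>, the exceptional case in the formula for
the order of \<open>R_perm \<omega>\<close>.\<close>
lemma map_order_of_isomorphic_R_perm:
  assumes "FS_solution X R" "2 \<le> map_order X R"
    "A \<noteq> {}" "B \<noteq> {}" "\<omega> \<in> carrier (BijGroup B)" "0 < group.ord (BijGroup B) \<omega>"
    "isomorphic X R (A \<times> B) (R_perm \<omega>)"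
  shows "map_order X R = 2 * group.ord (BijGroup B) \<omega>"
proof -
  have "R \<in> X \<times> X \<rightarrow> X \<times> X" using assms(1) by (simp add: FS_solution_def)
  moreover have "\<omega> \<in> B \<rightarrow> B" using assms(5) by (simp add: BijGroup_def Bij_imp_funcset)
  ultimately have "map_order X R = (if is_singleton B then 1 else 2 * group.ord (BijGroup B) \<omega>)"
    using isomorphic_R_perm_order(2)[OF assms(7) _ assms(3,4) _ has_order_BijGroup] assms(5,6) by blast
  then show ?thesis using assms(2) by (simp split: if_splits)
qed

section \<open>Solutions on a finite set and their isomorphism classes\<close>

text \<open>On a finite set both factors are replaced by initial segments of the positive integers, so that
the permutation becomes an element of the symmetric group of degree \<open>d\<close>.\<close>
definition standard_form :: "'a set \<Rightarrow> ('a \<times> 'a \<Rightarrow> 'a \<times> 'a) \<Rightarrow> nat \<Rightarrow> (nat \<Rightarrow> nat) \<Rightarrow> bool" where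
  "standard_form X R d p \<longleftrightarrow> d dvd card X \<and> p permutes {1..d} \<and>
     isomorphic X R ({1..card X div d} \<times> {1..d}) (R_perm p)"

lemma divisor_intervals_nonempty:
  assumes "finite X" "X \<noteq> {}" "d dvd card X"
  shows "{1..d} \<noteq> {}" "{1..card X div d} \<noteq> {}"
proof -
  have "0 < card X" using assms by (simp add: card_gt_0_iff)
  then have "0 < d" "0 < card X div d"
    using assms(3) dvd_pos_nat dvd_imp_le div_greater_zero_iff by blast+
  then show "{1..d} \<noteq> {}" "{1..card X div d} \<noteq> {}" by simp_all
qed

lemma standard_form_exists:
  assumes "finite X" "X \<noteq> {}" "FS_solution X R" "finite_order X R"
  shows "\<exists>d p. standard_form X R d p"
proof -
  have cl: "R \<in> X \<times> X \<rightarrow> X \<times> X" using assms(3) by (simp add: FS_solution_def)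
  from finite_order_solution_isomorphic_R_perm[OF assms(2-4)]
  obtain A B :: "'a set" and \<omega> where AB: "A \<noteq> {}" "B \<noteq> {}" "\<omega> \<in> carrier (BijGroup B)"
      "isomorphic X R (A \<times> B) (R_perm \<omega>)" by blast
  have \<omega>: "bij_betw \<omega> B B" using AB(3) by (simp add: BijGroup_def Bij_def)
  obtain \<sigma> where \<sigma>: "bij_betw \<sigma> X (A \<times> B)" using AB(4) by (auto simp: isomorphic_def)
  have "finite (A \<times> B)" using bij_betw_finite[OF \<sigma>] assms(1) by simp
  then have fin: "finite A" "finite B" using AB(1,2) by (auto dest: finite_cartesian_productD1 finite_cartesian_productD2)
  have card: "card X = card A * card B"
    using bij_betw_same_card[OF \<sigma>] by (simp add: card_cartesian_product)
  have "0 < card B" using fin AB(2) by (simp add: card_gt_0_iff)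
  define d where "d = card B"
  have d: "d dvd card X" "card X div d = card A" using card \<open>0 < card B\<close> by (simp_all add: d_def)
  have "\<exists>\<alpha>. bij_betw \<alpha> A {1..card X div d}" "\<exists>\<beta>. bij_betw \<beta> B {1..d}"
    by (rule finite_same_card_bij; simp add: fin d(2) d_def[symmetric])+
  then obtain \<alpha> \<beta> where \<alpha>: "bij_betw \<alpha> A {1..card X div d}" and \<beta>: "bij_betw \<beta> B {1..d}"
    by blast
  define p where "p i = (if i \<in> {1..d} then \<beta> (\<omega> (inv_into B \<beta> i)) else i)" for i
  have "bij_betw (\<beta> \<circ> \<omega> \<circ> inv_into B \<beta>) {1..d} {1..d}"
    using \<omega> \<beta> bij_betw_inv_into by (intro bij_betw_trans)
  then have "bij_betw p {1..d} {1..d}"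
    by (rule bij_betw_cong[THEN iffD1, rotated]) (simp add: p_def)
  then have p: "p permutes {1..d}" by (rule bij_imp_permutes) (auto simp: p_def)
  have "\<forall>b\<in>B. \<beta> (\<omega> b) = p (\<beta> b)"
    using bij_betw_apply[OF \<beta>] by (simp add: p_def bij_betw_inv_into_left[OF \<beta>])
  from isomorphic_R_perm_cong[OF \<alpha> \<beta> this]
  have "isomorphic X R ({1..card X div d} \<times> {1..d}) (R_perm p)"
    using isomorphic_trans[OF AB(4) _ cl] by blast
  then show ?thesis using d(1) p by (auto simp: standard_form_def)
qed

lemma standard_form_realized:
  assumes "finite X" "X \<noteq> {}" "d dvd card X" "p permutes {1..d}"
  shows "\<exists>R. FS_solution X R \<and> standard_form X R d p"
proof -
  have "card X = card ({1..card X div d} \<times> {1..d})"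
    using assms(3) by (simp add: card_cartesian_product)
  from finite_same_card_bij[OF assms(1) _ this]
  obtain \<sigma> where "bij_betw \<sigma> X ({1..card X div d} \<times> {1..d})" by auto
  moreover have "p \<in> {1..d} \<rightarrow> {1..d}" using permutes_in_image[OF assms(4)] by blast
  ultimately show ?thesis
    using transport_solution[OF _ R_perm_FS_solution] assms(3,4) unfolding standard_form_def by blast
qed

lemma standard_form_order:
  assumes "finite X" "X \<noteq> {}" "FS_solution X R" "standard_form X R d p"
  shows "finite_order X R" "map_order X R = (if d = 1 then 1 else 2 * group.ord (sym_group d) p)"
proof -
  have cl: "R \<in> X \<times> X \<rightarrow> X \<times> X" using assms(3) by (simp add: FS_solution_def)
  have sf: "d dvd card X" "p permutes {1..d}"
      "isomorphic X R ({1..card X div d} \<times> {1..d}) (R_perm p)"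
    using assms(4) by (auto simp: standard_form_def)
  have pc: "p \<in> {1..d} \<rightarrow> {1..d}" using permutes_in_image[OF sf(2)] by blast
  note * = isomorphic_R_perm_order[OF sf(3) cl divisor_intervals_nonempty(2,1)[OF assms(1,2) sf(1)] pc
      has_order_sym_group[OF sf(2) order_refl] sym_group_ord_bounds(1)[OF sf(2)]]
  show "finite_order X R" using * by blast
  show "map_order X R = (if d = 1 then 1 else 2 * group.ord (sym_group d) p)"
    using * by (simp add: is_singleton_altdef)
qed

text \<open>The degree \<open>d\<close> and the conjugacy class of \<open>p\<close> form a complete isomorphism invariant. An
isomorphism of solutions induces a conjugating bijection between the second factors, and
conversely such a bijection extends to the products because the first factors coincide once
the degrees do.\<close>
lemma standard_form_isomorphic_iff:
  assumes "finite X" "X \<noteq> {}" "FS_solution X R" "standard_form X R d p"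
    "FS_solution X R'" "standard_form X R' d' p'"
  shows "isomorphic X R X R' \<longleftrightarrow>
    d = d' \<and> conj_class (sym_group d) p = conj_class (sym_group d') p'"
proof -
  have cl: "R \<in> X \<times> X \<rightarrow> X \<times> X" "R' \<in> X \<times> X \<rightarrow> X \<times> X"
    using assms(3,5) by (simp_all add: FS_solution_def)
  have sf: "d dvd card X" "p permutes {1..d}"
      "isomorphic X R ({1..card X div d} \<times> {1..d}) (R_perm p)"
      "p' permutes {1..d'}"
      "isomorphic X R' ({1..card X div d'} \<times> {1..d'}) (R_perm p')"
    using assms(4,6) by (auto simp: standard_form_def)
  have "p \<in> {1..d} \<rightarrow> {1..d}" using permutes_in_image[OF sf(2)] by blast
  note pcl = R_perm_closed[OF this, of "{1..card X div d}"]
  have "isomorphic X R X R' \<longleftrightarrow> isomorphic ({1..card X div d} \<times> {1..d}) (R_perm p)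
      ({1..card X div d'} \<times> {1..d'}) (R_perm p')"
    using isomorphic_trans isomorphic_sym sf(3,5) cl pcl by metis
  also have "\<dots> \<longleftrightarrow> d = d' \<and> conj_class (sym_group d) p = conj_class (sym_group d') p'"
  proof
    assume "isomorphic ({1..card X div d} \<times> {1..d}) (R_perm p)
      ({1..card X div d'} \<times> {1..d'}) (R_perm p')"
    then obtain h where h: "bij_betw h {1..d} {1..d'}" "\<forall>b\<in>{1..d}. h (p b) = p' (h b)"
      using isomorphic_R_perm_imp_conj divisor_intervals_nonempty[OF assms(1,2) sf(1)] by metis
    then have "d = d'" using bij_betw_same_card by fastforce
    then show "d = d' \<and> conj_class (sym_group d) p = conj_class (sym_group d') p'"
      using h sf(2,4) conj_class_sym_group_eq_iff by blast
  next
    assume *: "d = d' \<and> conj_class (sym_group d) p = conj_class (sym_group d') p'"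
    then obtain h where "bij_betw h {1..d} {1..d'}" "\<forall>b\<in>{1..d}. h (p b) = p' (h b)"
      using sf(2,4) conj_class_sym_group_eq_iff by blast
    then show "isomorphic ({1..card X div d} \<times> {1..d}) (R_perm p)
      ({1..card X div d'} \<times> {1..d'}) (R_perm p')"
      using isomorphic_R_perm_cong[OF bij_betw_id] * by blast
  qed
  finally show ?thesis .
qed

text \<open>The classes of the kernel of an invariant \<open>\<Phi>\<close> are its nonempty fibres. As \<open>S\<close> may be infinite,
the equality is obtained from a bijection with the values of \<open>\<Phi>\<close>.\<close>
lemma card_quotient_kernel:
  assumes "\<And>x y. x \<in> S \<Longrightarrow> y \<in> S \<Longrightarrow> P x y \<longleftrightarrow> \<Phi> x = \<Phi> y"
  shows "card (S // {(x, y). x \<in> S \<and> y \<in> S \<and> P x y}) = card (\<Phi> ` S)"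
proof -
  let ?fibre = "\<lambda>v. {y \<in> S. \<Phi> y = v}"
  have "{(x, y). x \<in> S \<and> y \<in> S \<and> P x y} `` {x} = ?fibre (\<Phi> x)" if "x \<in> S" for x
    using assms that by auto
  then have "S // {(x, y). x \<in> S \<and> y \<in> S \<and> P x y} = ?fibre ` (\<Phi> ` S)"
    unfolding quotient_def by blast
  moreover have "inj_on ?fibre (\<Phi> ` S)" by (rule inj_onI) blast
  ultimately show ?thesis by (simp add: card_image)
qed

text \<open>The condition \<open>Q\<close> restricts the order of the solutions; it has to be visible in the degree \<open>d\<close>
of the standard form. With \<open>D\<close> the set of all numbers this counts all solutions of finite
order, and with \<open>1\<close> left out those of order at least \<open>2\<close>.\<close>
lemma card_iso_classes:
  assumes X: "finite X" "X \<noteq> {}"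
    and Q: "\<And>R d p. FS_solution X R \<Longrightarrow> standard_form X R d p \<Longrightarrow> Q R \<longleftrightarrow> d \<in> D"
  shows "card (iso_classes X {R. FS_solution X R \<and> finite_order X R \<and> Q R}) =
    (\<Sum>d | d dvd card X \<and> d \<in> D. \<Sum>k = 1..landau d. num_conj_classes d k)"
proof -
  define S where "S = {R. FS_solution X R \<and> finite_order X R \<and> Q R}"
  define V where "V = (SIGMA d:{d. d dvd card X \<and> d \<in> D}. conj_class (sym_group d) ` {p. p permutes {1..d}})"
  have "\<forall>R\<in>S. \<exists>d p. standard_form X R d p"
    using standard_form_exists[OF X] by (simp add: S_def)
  then obtain d p where dp: "\<And>R. R \<in> S \<Longrightarrow> standard_form X R (d R) (p R)" by metis
  define \<Phi> where "\<Phi> R = (d R, conj_class (sym_group (d R)) (p R))" for R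
  \<comment> \<open>The chosen standard forms may be replaced by any others, since the invariant of \<open>R\<close> is
    unique: the identity is an isomorphism from \<open>R\<close> to itself.\<close>
  have \<Phi>: "\<Phi> R = (e, conj_class (sym_group e) q)" if "R \<in> S" "standard_form X R e q" for R e q
  proof -
    have FS: "FS_solution X R" using that(1) by (simp add: S_def)
    have "isomorphic X R X R"
      unfolding isomorphic_def by (intro exI[of _ id]) (auto simp: map_prod.id)
    with standard_form_isomorphic_iff[OF X FS dp[OF that(1)] FS that(2)] show ?thesis
      unfolding \<Phi>_def by blast
  qed
  have "\<Phi> ` S = V"
  proof (intro equalityI subsetI)
    fix v assume "v \<in> \<Phi> ` S"
    then obtain R where R: "R \<in> S" "v = \<Phi> R" by blast
    have "d R \<in> D" using Q[OF _ dp[OF R(1)]] R(1) by (simp add: S_def)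
    then show "v \<in> V" using dp[OF R(1)] by (auto simp: R(2) \<Phi>_def V_def standard_form_def)
  next
    fix v assume "v \<in> V"
    then obtain e q where e: "e dvd card X" "e \<in> D" "q permutes {1..e}"
        "v = (e, conj_class (sym_group e) q)" by (auto simp: V_def)
    obtain R where R: "FS_solution X R" "standard_form X R e q"
      using standard_form_realized[OF X e(1,3)] by blast
    then have "R \<in> S" using standard_form_order(1)[OF X R] Q[OF R] e(2) by (simp add: S_def)
    then show "v \<in> \<Phi> ` S" using \<Phi>[OF _ R(2)] e(4) by force
  qed
  moreover have "card (iso_classes X S) = card (\<Phi> ` S)"
    unfolding iso_classes_def
  proof (rule card_quotient_kernel)
    fix R R' assume "R \<in> S" "R' \<in> S"
    then show "isomorphic X R X R' \<longleftrightarrow> \<Phi> R = \<Phi> R'"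
      using standard_form_isomorphic_iff[OF X _ dp _ dp, of R R'] by (simp add: S_def \<Phi>_def)
  qed
  moreover have "card V = (\<Sum>d | d dvd card X \<and> d \<in> D. \<Sum>k = 1..landau d. num_conj_classes d k)"
  proof -
    have "finite {d. d dvd card X \<and> d \<in> D}" using X by (simp add: card_gt_0_iff)
    then show ?thesis unfolding V_def card_conj_classes_sym_group[symmetric]
      by (rule card_SigmaI) (intro ballI finite_imageI finite_permutations finite_atLeastAtMost)
  qed
  ultimately show ?thesis by (simp add: S_def)
qed

text \<open>The bound is attained by taking \<open>A\<close> to be a singleton and \<open>B\<close> of full size, with a permutation
of maximal order. Two elements are required: on a singleton the only solution is the identity,
of order \<open>1\<close>.\<close>
lemma Max_map_order:
  assumes X: "finite X" "2 \<le> card X"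
  shows "Max {map_order X R | R. FS_solution X R \<and> finite_order X R} = 2 * landau (card X)"
proof (rule Max_eqI)
  have ne: "X \<noteq> {}" using X(2) by auto
  have ub: "y \<le> 2 * landau (card X)"
    if "y \<in> {map_order X R | R. FS_solution X R \<and> finite_order X R}" for y
  proof -
    from that obtain R where R: "y = map_order X R" "FS_solution X R" "finite_order X R" by blast
    obtain d p where sf: "standard_form X R d p"
      using standard_form_exists[OF X(1) ne R(2,3)] by blast
    have "p permutes {1..d}" "d \<le> card X"
      using sf X(2) by (auto simp: standard_form_def intro: dvd_imp_le)
    then have "0 < group.ord (sym_group d) p" "group.ord (sym_group d) p \<le> landau (card X)"
      using sym_group_ord_bounds landau_mono le_trans by blast+
    then show ?thesis using standard_form_order(2)[OF X(1) ne R(2) sf] R(1) by auto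
  qed
  then show "\<And>y. y \<in> {map_order X R | R. FS_solution X R \<and> finite_order X R} \<Longrightarrow>
    y \<le> 2 * landau (card X)" .
  show "finite {map_order X R | R. FS_solution X R \<and> finite_order X R}"
    by (rule finite_subset[of _ "{..2 * landau (card X)}"]) (use ub in blast, simp)
  obtain p where p: "p permutes {1..card X}" "group.ord (sym_group (card X)) p = landau (card X)"
    using landau_attained by blast
  obtain R where R: "FS_solution X R" "standard_form X R (card X) p"
    using standard_form_realized[OF X(1) ne dvd_refl p(1)] by blast
  have "map_order X R = 2 * landau (card X)" "finite_order X R"
    using standard_form_order[OF X(1) ne R] X(2) p(2) by simp_all
  then show "2 * landau (card X) \<in> {map_order X R | R. FS_solution X R \<and> finite_order X R}"
    using R(1) by force
qed

theorem corollary2p26: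
  shows "(\<forall>(X :: 'a set) R (m :: nat).
            X \<noteq> {} \<and> FS_solution X R \<and> finite_order X R \<and> 2 \<le> map_order X R \<and> 0 < m \<longrightarrow>
              even (map_order X R) \<and>
              (map_order X R = 2 * m \<longleftrightarrow>
                 (\<exists>(A :: 'a set) (B :: 'a set) \<omega>. A \<noteq> {} \<and> B \<noteq> {} \<and>
                    \<omega> \<in> carrier (BijGroup B) \<and> group.ord (BijGroup B) \<omega> = m \<and>
                    isomorphic X R (A \<times> B) (R_perm \<omega>))) \<and>
              (\<forall>(A :: 'b set) (B :: 'c set) \<omega>. A \<noteq> {} \<and> B \<noteq> {} \<and>
                    \<omega> \<in> carrier (BijGroup B) \<and> group.ord (BijGroup B) \<omega> = m \<and>
                    isomorphic X R (A \<times> B) (R_perm \<omega>) \<longrightarrow> map_order X R = 2 * m))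
       \<and> (\<forall>(X :: 'a set) (n :: nat). X \<noteq> {} \<and> finite X \<and> card X = n \<longrightarrow>
            (2 \<le> n \<longrightarrow>
              Max {map_order X R | R. FS_solution X R \<and> finite_order X R} = 2 * landau n) \<and>
            card (iso_classes X {R. FS_solution X R \<and> finite_order X R}) =
              (\<Sum>d | d dvd n. \<Sum>k = 1..landau d. num_conj_classes d k) \<and>
            card (iso_classes X {R. FS_solution X R \<and> finite_order X R \<and> 2 \<le> map_order X R}) =
              (\<Sum>d | d dvd n \<and> d \<noteq> 1. \<Sum>k = 1..landau d. num_conj_classes d k))"
proof (intro conjI allI impI; elim conjE)
  fix X :: "'a set" and R and m :: nat
  assume X: "X \<noteq> {}" "FS_solution X R" "finite_order X R" "2 \<le> map_order X R" "0 < m"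
  from finite_order_solution_isomorphic_R_perm[OF X(1-3)]
  obtain A B :: "'a set" and \<omega> where AB: "A \<noteq> {}" "B \<noteq> {}" "\<omega> \<in> carrier (BijGroup B)"
      "0 < group.ord (BijGroup B) \<omega>" "isomorphic X R (A \<times> B) (R_perm \<omega>)" by blast
  have ord: "map_order X R = 2 * group.ord (BijGroup B) \<omega>"
    using map_order_of_isomorphic_R_perm[OF X(2,4) AB] .
  then show "even (map_order X R)" by simp
  show "map_order X R = 2 * m \<longleftrightarrow>
      (\<exists>(A :: 'a set) (B :: 'a set) \<omega>. A \<noteq> {} \<and> B \<noteq> {} \<and>
        \<omega> \<in> carrier (BijGroup B) \<and> group.ord (BijGroup B) \<omega> = m \<and>
        isomorphic X R (A \<times> B) (R_perm \<omega>))" (is "?lhs \<longleftrightarrow> ?rhs")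
  proof
    assume ?lhs
    then have "group.ord (BijGroup B) \<omega> = m" using ord by simp
    then show ?rhs using AB by blast
  next
    assume ?rhs
    then obtain A' B' :: "'a set" and \<omega>' where "A' \<noteq> {}" "B' \<noteq> {}"
        "\<omega>' \<in> carrier (BijGroup B')" and m: "group.ord (BijGroup B') \<omega>' = m"
        and "isomorphic X R (A' \<times> B') (R_perm \<omega>')" by blast
    then show ?lhs using map_order_of_isomorphic_R_perm[OF X(2,4), of A' B' \<omega>'] X(5) by simp
  qed
next
  fix X :: "'a set" and R and m :: nat and A :: "'b set" and B :: "'c set" and \<omega>
  assume "FS_solution X R" "2 \<le> map_order X R" "0 < m" "A \<noteq> {}" "B \<noteq> {}"
    "\<omega> \<in> carrier (BijGroup B)" "group.ord (BijGroup B) \<omega> = m"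
    "isomorphic X R (A \<times> B) (R_perm \<omega>)"
  then show "map_order X R = 2 * m" using map_order_of_isomorphic_R_perm[of X R A B \<omega>] by simp
next
  fix X :: "'a set" and n :: nat
  assume X: "X \<noteq> {}" "finite X" "card X = n"
  show "2 \<le> n \<Longrightarrow> Max {map_order X R | R. FS_solution X R \<and> finite_order X R} = 2 * landau n"
    using Max_map_order X by blast
  show "card (iso_classes X {R. FS_solution X R \<and> finite_order X R}) =
      (\<Sum>d | d dvd n. \<Sum>k = 1..landau d. num_conj_classes d k)"
    using card_iso_classes[OF X(2,1), of "\<lambda>_. True" UNIV] X(3) by simp
  \<comment> \<open>Since the order is \<open>1\<close> for \<open>d = 1\<close> and otherwise a positive even number, only \<open>d = 1\<close> is
    excluded.\<close>
  have "2 \<le> map_order X R \<longleftrightarrow> d \<in> - {1}"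
    if "FS_solution X R" "standard_form X R d p" for R d p
  proof -
    have "0 < group.ord (sym_group d) p"
      using that(2) sym_group_ord_bounds(1) by (simp add: standard_form_def)
    then show ?thesis using standard_form_order(2)[OF X(2,1) that] by auto
  qed
  from card_iso_classes[OF X(2,1) this]
  show "card (iso_classes X {R. FS_solution X R \<and> finite_order X R \<and> 2 \<le> map_order X R}) =
      (\<Sum>d | d dvd n \<and> d \<noteq> 1. \<Sum>k = 1..landau d. num_conj_classes d k)"
    using X(3) by simp
qed

end
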